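(* Let $G$ be a graph on $n$ vertices with minimum degree $\delta(G)\geq \left(\frac{7+\sqrt{21}}{14}\right)n$. Then $G$ admits a fractional $K_3$-decomposition.
   Context: A fractional $K_3$-decomposition (fractional triangle decomposition) of a graph $G$ is a function $w$ from the set of triangles ($K_3$ subgraphs) of $G$ to the non-negative reals such that for every edge $e\in E(G)$, the sum of $w(T)$ over all triangles $T$ of $G$ containing $e$ equals $1$. *)

theory Defs
  imports Complex_Main
begin

text \<open>Finite simple graphs, given by a vertex set and a set of two-element edges.\<close>

definition simple_graph :: "'a set \<Rightarrow> 'a set set \<Rightarrow> bool" where
  "simple_graph V E \<longleftrightarrow> finite V \<and> (\<forall>e\<in>E. e \<subseteq> V \<and> card e = 2)"

definition degree :: "'a set set \<Rightarrow> 'a \<Rightarrow> nat" where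
  "degree E v = card {e \<in> E. v \<in> e}"

text \<open>Only meaningful for nonempty \<open>V\<close>, since \<open>Min {}\<close> is unspecified.\<close>

definition min_degree :: "'a set \<Rightarrow> 'a set set \<Rightarrow> nat" where
  "min_degree V E = Min (degree E ` V)"

text \<open>
  A \<open>K\<^sub>3\<close> subgraph is determined by its three vertices, so it is represented by its vertex set;
  it contains the edge \<open>e\<close> iff \<open>e \<subseteq> T\<close>.
\<close>

definition triangles :: "'a set \<Rightarrow> 'a set set \<Rightarrow> 'a set set" where
  "triangles V E = {T. T \<subseteq> V \<and> card T = 3 \<and> (\<forall>e. e \<subseteq> T \<and> card e = 2 \<longrightarrow> e \<in> E)}"

text \<open>The values of \<open>w\<close> outside \<open>triangles V E\<close> are irrelevant.\<close>

definition fractional_triangle_decomposition ::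
    "'a set \<Rightarrow> 'a set set \<Rightarrow> ('a set \<Rightarrow> real) \<Rightarrow> bool" where
  "fractional_triangle_decomposition V E w \<longleftrightarrow>
     (\<forall>T\<in>triangles V E. 0 \<le> w T) \<and>
     (\<forall>e\<in>E. (\<Sum>T | T \<in> triangles V E \<and> e \<subseteq> T. w T) = 1)"

end

theory Submission
  imports Defs
begin

text \<open>
  Write \<open>g(e) = 1/t(e)\<close>, where \<open>t(e)\<close> is the number of triangles containing the edge \<open>e\<close>. If every
  triangle gets weight \<open>(g(e\<^sub>1) + g(e\<^sub>2) + g(e\<^sub>3))/3\<close>, summed over its edges, then the edge \<open>ux\<close> has
  weight 1 up to an excess of \<open>(g(vx) - g(ux))/3\<close> and \<open>(g(uv) - g(ux))/3\<close> from each triangle \<open>uvx\<close>.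
  These excesses are antisymmetric: for an edge \<open>uv\<close>, one has to move weight
  \<open>(g(ux) - g(vx))/3\<close> from \<open>vx\<close> to \<open>ux\<close> for all common neighbours \<open>x\<close>. Adding \<open>m(xy)\<close> to the triangles
  \<open>uxy\<close> and subtracting it from \<open>vxy\<close>, for all edges \<open>xy\<close> between common neighbours of \<open>u\<close> and \<open>v\<close>, does
  exactly this provided that \<open>m\<close> has the vertex sums \<open>(g(ux) - g(vx))/3\<close>. We take
  \<open>m(xy) = (\<theta>(x) + \<theta>(y))/3\<close>, which leads to a linear system for \<open>\<theta>\<close> that is diagonally dominant up to
  a rank-one term. It remains to bound \<open>\<theta>\<close> from below so that no triangle weight becomes negative. The
  mean of the right-hand side is small, because \<open>t(vx)\<close> exceeds its least possible value by the number
  of common non-neighbours of \<open>v\<close> and \<open>x\<close>, and on average over \<open>x\<close> this number is small.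
\<close>

section \<open>Diagonally dominant systems\<close>

text \<open>Jacobi iteration from zero: as \<open>b\<close> is nonnegative the iterates
  \<open>X k\<close> increase, dominance keeps them bounded, and the limit solves the
  system.\<close>

lemma diag_dominant_nonneg_solution:
  fixes R :: "'a \<Rightarrow> 'a \<Rightarrow> bool" and d b :: "'a \<Rightarrow> real"
  assumes "finite C" "gap > 0"
    and d: "\<And>a. a \<in> C \<Longrightarrow> real (card {y\<in>C. R a y}) + gap \<le> d a"
    and b: "\<And>a. a \<in> C \<Longrightarrow> 0 \<le> b a"
  shows "\<exists>\<psi>. \<forall>a\<in>C. d a * \<psi> a - (\<Sum>y | y \<in> C \<and> R a y. \<psi> y) = b a"
proof -
  define X where "X = rec_nat (\<lambda>_. 0) (\<lambda>_ \<psi> a. (b a + (\<Sum>y | y \<in> C \<and> R a y. \<psi> y)) / d a)"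
  have X0: "X 0 = (\<lambda>_. 0)" and XS: "X (Suc k) a = (b a + (\<Sum>y | y \<in> C \<and> R a y. X k y)) / d a" for k a
    by (simp_all add: X_def)
  \<comment> \<open>Chosen so that \<open>b a \<le> gap * M\<close> for all \<open>a\<close>; by
    dominance the bound \<open>M\<close> then survives each iteration.\<close>
  define M where "M = (\<Sum>a\<in>C. b a) / gap"
  have M0: "M \<ge> 0" using assms by (simp add: M_def sum_nonneg)
  have bM: "b a \<le> gap * M" if "a \<in> C" for a
    using that assms by (auto simp: M_def intro!: member_le_sum)
  have dpos: "d a > 0" if "a \<in> C" for a
    using d[OF that] assms(2) by linarith
  have le: "X k a \<le> M" if "a \<in> C" for k a
    using that
  proof (induction k arbitrary: a)
    case (Suc k)
    have "(\<Sum>y | y \<in> C \<and> R a y. X k y) \<le> real (card {y\<in>C. R a y}) * M"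
      using sum_bounded_above[of "{y\<in>C. R a y}" "X k" M] Suc.IH by auto
    then have "b a + (\<Sum>y | y \<in> C \<and> R a y. X k y) \<le> (real (card {y\<in>C. R a y}) + gap) * M"
      using bM[OF Suc.prems] by (simp add: algebra_simps)
    also have "\<dots> \<le> d a * M" using d[OF Suc.prems] M0 by (rule mult_right_mono)
    finally show ?case using dpos[OF Suc.prems] by (simp add: XS pos_divide_le_eq mult.commute)
  qed (simp add: X0 M0)
  have mono: "X k a \<le> X (Suc k) a" if "a \<in> C" for k a
    using that
  proof (induction k arbitrary: a)
    case 0 then show ?case using b dpos by (simp add: X0 XS less_imp_le)
  next
    case (Suc k)
    have "(\<Sum>y | y \<in> C \<and> R a y. X k y) \<le> (\<Sum>y | y \<in> C \<and> R a y. X (Suc k) y)"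
      using Suc.IH by (intro sum_mono) auto
    then show ?case using dpos[OF Suc.prems] unfolding XS[of k a] XS[of "Suc k" a]
      by (intro divide_right_mono) auto
  qed
  have "\<exists>l. (\<lambda>k. X k a) \<longlonglongrightarrow> l" if "a \<in> C" for a
    using incseq_convergent[of "\<lambda>k. X k a" M] mono[OF that] le[OF that] by (metis incseq_SucI)
  then obtain l where l: "\<And>a. a \<in> C \<Longrightarrow> (\<lambda>k. X k a) \<longlonglongrightarrow> l a" by metis
  have "d a * l a - (\<Sum>y | y \<in> C \<and> R a y. l y) = b a" if "a \<in> C" for a
  proof -
    have "(\<lambda>k. X (Suc k) a) \<longlonglongrightarrow> (b a + (\<Sum>y | y \<in> C \<and> R a y. l y)) / d a"
      unfolding XS using dpos[OF that] l by (intro tendsto_intros) auto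
    moreover have "(\<lambda>k. X (Suc k) a) \<longlonglongrightarrow> l a" using l[OF that] by (rule LIMSEQ_Suc)
    ultimately have "l a = (b a + (\<Sum>y | y \<in> C \<and> R a y. l y)) / d a"
      using LIMSEQ_unique by blast
    then show ?thesis using dpos[OF that] by (simp add: field_simps)
  qed
  then show ?thesis by blast
qed

lemma diag_dominant_solution:
  fixes R :: "'a \<Rightarrow> 'a \<Rightarrow> bool" and d b :: "'a \<Rightarrow> real"
  assumes "finite C" "gap > 0"
    and d: "\<And>a. a \<in> C \<Longrightarrow> real (card {y\<in>C. R a y}) + gap \<le> d a"
  obtains \<psi> where "\<And>a. a \<in> C \<Longrightarrow> d a * \<psi> a - (\<Sum>y | y \<in> C \<and> R a y. \<psi> y) = b a"
proof -
  have r: "real (card {y\<in>C. R a y}) + gap \<le> d a" if "a \<in> C" for a by (rule d[OF that])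
  obtain p where p: "\<forall>a\<in>C. d a * p a - (\<Sum>y | y \<in> C \<and> R a y. p y) = max 0 (b a)"
    using diag_dominant_nonneg_solution[where R = R and d = d and b = "\<lambda>a. max 0 (b a)", OF assms(1,2) r] by auto
  obtain q where q: "\<forall>a\<in>C. d a * q a - (\<Sum>y | y \<in> C \<and> R a y. q y) = max 0 (- b a)"
    using diag_dominant_nonneg_solution[where R = R and d = d and b = "\<lambda>a. max 0 (- b a)", OF assms(1,2) r] by auto
  have "d a * (p a - q a) - (\<Sum>y | y \<in> C \<and> R a y. p y - q y) = b a" if "a \<in> C" for a
    using p[rule_format, OF that] q[rule_format, OF that] by (simp add: algebra_simps sum_subtractf)
  then show ?thesis by (rule that)
qed

text \<open>Minimum principle: in the row of a minimiser \<open>a\<close> with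
  \<open>\<psi> a < 0\<close>, replacing every \<open>\<psi> y\<close> by \<open>\<psi> a\<close>
  leaves \<open>- K \<le> gap * \<psi> a\<close>.\<close>

lemma diag_dominant_lower_bound:
  fixes R :: "'a \<Rightarrow> 'a \<Rightarrow> bool" and d \<psi> :: "'a \<Rightarrow> real"
  assumes "finite C" "gap > 0" "K \<ge> 0"
    and d: "\<And>a. a \<in> C \<Longrightarrow> real (card {y\<in>C. R a y}) + gap \<le> d a"
    and eq: "\<And>a. a \<in> C \<Longrightarrow> - K \<le> d a * \<psi> a - (\<Sum>y | y \<in> C \<and> R a y. \<psi> y)"
    and "x \<in> C"
  shows "- K / gap \<le> \<psi> x"
proof (rule ccontr)
  assume neg: "\<not> - K / gap \<le> \<psi> x"
  define a where "a = arg_min_on \<psi> C"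
  have a: "a \<in> C" and min: "\<And>y. y \<in> C \<Longrightarrow> \<psi> a \<le> \<psi> y"
    using assms arg_min_if_finite[of C \<psi>] unfolding a_def by (auto simp: not_less)
  have lt: "\<psi> a < - K / gap" using min[OF \<open>x \<in> C\<close>] neg by linarith
  have "\<psi> a < 0" using lt assms by (smt (verit) divide_nonneg_pos minus_divide_left)
  have "real (card {y\<in>C. R a y}) * \<psi> a \<le> (\<Sum>y | y \<in> C \<and> R a y. \<psi> y)"
    using sum_bounded_below[of "{y\<in>C. R a y}" "\<psi> a" \<psi>] min by auto
  moreover have "d a * \<psi> a \<le> (real (card {y\<in>C. R a y}) + gap) * \<psi> a"
    using d[OF a] \<open>\<psi> a < 0\<close> by (intro mult_right_mono_neg) auto
  ultimately have "- K \<le> gap * \<psi> a" using eq[OF a] by (simp add: algebra_simps)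
  then show False using lt assms(2) by (simp add: field_simps)
qed

section \<open>Vertex weights with prescribed sums over neighbours\<close>

lemma sum_pairs_complement:
  fixes R :: "'a \<Rightarrow> 'a \<Rightarrow> bool" and \<theta> :: "'a \<Rightarrow> real"
  assumes "finite C"
  shows "(\<Sum>y | y \<in> C \<and> \<not> R a y. \<theta> a + \<theta> y)
    = (real (card C) - real (card {y\<in>C. R a y})) * \<theta> a + sum \<theta> C - (\<Sum>y | y \<in> C \<and> R a y. \<theta> y)"
proof -
  have split: "C = {y\<in>C. R a y} \<union> {y\<in>C. \<not> R a y}" by auto
  have "sum \<theta> C = (\<Sum>y | y \<in> C \<and> R a y. \<theta> y) + (\<Sum>y | y \<in> C \<and> \<not> R a y. \<theta> y)"
    by (subst split, rule sum.union_disjoint) (use assms in auto)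
  moreover have "card C = card {y\<in>C. R a y} + card {y\<in>C. \<not> R a y}"
    by (subst split, rule card_Un_disjoint) (use assms in auto)
  ultimately show ?thesis by (simp add: sum.distrib)
qed

text \<open>The adjacency matrix of the complement gives a diagonally dominant system; passing to the
  adjacency matrix itself is a rank-one correction.\<close>

lemma edge_weights_with_vertex_sums:
  fixes R :: "'a \<Rightarrow> 'a \<Rightarrow> bool" and s :: "'a \<Rightarrow> real"
  assumes C: "finite C" and gap: "gap > 0"
    and R: "\<And>a. a \<in> C \<Longrightarrow> 2 * real (card {y\<in>C. R a y}) + gap \<le> real (card C)"
  obtains \<theta> where "\<And>a. a \<in> C \<Longrightarrow> (\<Sum>y | y \<in> C \<and> \<not> R a y. \<theta> a + \<theta> y) = s a"
proof -
  define d where "d a = real (card C) - real (card {y\<in>C. R a y})" for a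
  have d: "real (card {y\<in>C. R a y}) + gap \<le> d a" if "a \<in> C" for a
    using R[OF that] by (simp add: d_def)
  obtain \<phi> where \<phi>: "\<And>a. a \<in> C \<Longrightarrow> d a * \<phi> a - (\<Sum>y | y \<in> C \<and> R a y. \<phi> y) = 1"
    using diag_dominant_solution[where R = R and d = d and b = "\<lambda>_. 1", OF C gap d] by blast
  obtain \<psi> where \<psi>: "\<And>a. a \<in> C \<Longrightarrow> d a * \<psi> a - (\<Sum>y | y \<in> C \<and> R a y. \<psi> y) = s a"
    using diag_dominant_solution[where R = R and d = d and b = s, OF C gap d] by blast
  have "0 \<le> \<phi> a" if "a \<in> C" for a
    using diag_dominant_lower_bound[where R = R and d = d and K = 0 and \<psi> = \<phi>, OF C gap _ d _ that] \<phi> by auto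
  then have \<phi>0: "0 \<le> sum \<phi> C" by (simp add: sum_nonneg)
  \<comment> \<open>Forced by the requirement \<open>sum \<theta> C = c\<close>: the dominant system
    for \<open>\<theta>\<close> then has right-hand side
    \<open>s a - sum \<theta> C\<close>.\<close>
  define c where "c = sum \<psi> C / (1 + sum \<phi> C)"
  define \<theta> where "\<theta> a = \<psi> a - c * \<phi> a" for a
  have "c * (1 + sum \<phi> C) = sum \<psi> C" using \<phi>0 by (simp add: c_def)
  moreover have "sum \<theta> C = sum \<psi> C - c * sum \<phi> C"
    by (simp add: \<theta>_def sum_subtractf sum_distrib_left)
  ultimately have sum\<theta>: "sum \<theta> C = c" by (simp add: algebra_simps)
  have "(\<Sum>y | y \<in> C \<and> \<not> R a y. \<theta> a + \<theta> y) = s a" if "a \<in> C" for a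
  proof -
    have "(\<Sum>y | y \<in> C \<and> R a y. \<theta> y)
        = (\<Sum>y | y \<in> C \<and> R a y. \<psi> y) - c * (\<Sum>y | y \<in> C \<and> R a y. \<phi> y)"
      by (simp add: \<theta>_def sum_subtractf sum_distrib_left)
    moreover have "(\<Sum>y | y \<in> C \<and> R a y. \<psi> y) = d a * \<psi> a - s a"
      "(\<Sum>y | y \<in> C \<and> R a y. \<phi> y) = d a * \<phi> a - 1"
      using \<phi>[OF that] \<psi>[OF that] by auto
    ultimately show ?thesis
      unfolding sum_pairs_complement[OF C] sum\<theta> d_def[symmetric]
      by (simp add: \<theta>_def algebra_simps)
  qed
  then show ?thesis by (rule that)
qed

text \<open>Duality: pair the system for \<open>\<theta>\<close> with the solution
  \<open>\<phi>\<close> for the constant right-hand side 1. As \<open>R\<close> is symmetric,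
  \<open>(1 + F) * sum \<theta> C\<close> equals the sum of \<open>\<phi> a * s a\<close>, where
  \<open>F = sum \<phi> C\<close>. It remains to use \<open>0 \<le> \<phi> a \<le> 1 / gap\<close>
  and \<open>F \<ge> 1\<close>.\<close>

lemma sum_vertex_weights_le:
  fixes R :: "'a \<Rightarrow> 'a \<Rightarrow> bool" and s e \<theta> :: "'a \<Rightarrow> real"
  assumes C: "finite C" "C \<noteq> {}" and gap: "gap > 0"
    and sym: "\<And>a y. R a y \<longleftrightarrow> R y a"
    and R: "\<And>a. a \<in> C \<Longrightarrow> 2 * real (card {y\<in>C. R a y}) + gap \<le> real (card C)"
    and \<theta>: "\<And>a. a \<in> C \<Longrightarrow> (\<Sum>y | y \<in> C \<and> \<not> R a y. \<theta> a + \<theta> y) = s a"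
    and s: "\<And>a. a \<in> C \<Longrightarrow> s a \<le> \<kappa> + e a"
    and e: "\<And>a. a \<in> C \<Longrightarrow> 0 \<le> e a" "sum e C \<le> I"
  shows "sum \<theta> C \<le> (if \<kappa> \<ge> 0 then \<kappa> else \<kappa> / 2) + I / (2 * gap)"
proof -
  define d where "d a = real (card C) - real (card {y\<in>C. R a y})" for a
  have d: "real (card {y\<in>C. R a y}) + gap \<le> d a" if "a \<in> C" for a
    using R[OF that] by (simp add: d_def)
  obtain \<phi> where \<phi>: "\<And>a. a \<in> C \<Longrightarrow> d a * \<phi> a - (\<Sum>y | y \<in> C \<and> R a y. \<phi> y) = 1"
    using diag_dominant_solution[where R = R and d = d and b = "\<lambda>_. 1", OF C(1) gap d] by blast
  have \<phi>0: "0 \<le> \<phi> a" if "a \<in> C" for a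
    using diag_dominant_lower_bound[where R = R and d = d and K = 0 and \<psi> = \<phi>, OF C(1) gap _ d _ that] \<phi> by auto
  have \<phi>1: "\<phi> a \<le> 1 / gap" if "a \<in> C" for a
    using diag_dominant_lower_bound[where R = R and d = d and K = 1 and \<psi> = "\<lambda>y. - \<phi> y", OF C(1) gap _ d _ that] \<phi>
    by (force simp: sum_negf)
  define F where "F = sum \<phi> C"
  have cC: "real (card C) > 0" using C by (simp add: card_gt_0_iff)
  have "1 / real (card C) \<le> \<phi> a" if "a \<in> C" for a
  proof -
    have "1 \<le> d a * \<phi> a" using \<phi>[OF that] \<phi>0 sum_nonneg[of "{y\<in>C. R a y}" \<phi>] by auto
    also have "\<dots> \<le> real (card C) * \<phi> a" using \<phi>0[OF that] by (intro mult_right_mono) (auto simp: d_def)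
    finally show ?thesis using cC by (simp add: field_simps)
  qed
  then have F1: "1 \<le> F"
    using sum_bounded_below[of C "1 / real (card C)" \<phi>] cC by (simp add: F_def)
  have \<theta>': "d a * \<theta> a - (\<Sum>y | y \<in> C \<and> R a y. \<theta> y) = s a - sum \<theta> C" if "a \<in> C" for a
    using \<theta>[OF that] unfolding sum_pairs_complement[OF C(1)] d_def by simp
  have swap: "(\<Sum>a\<in>C. \<phi> a * (\<Sum>y | y \<in> C \<and> R a y. \<theta> y)) = (\<Sum>a\<in>C. \<theta> a * (\<Sum>y | y \<in> C \<and> R a y. \<phi> y))"
  proof -
    have "(\<Sum>a\<in>C. \<phi> a * (\<Sum>y | y \<in> C \<and> R a y. \<theta> y)) = (\<Sum>a\<in>C. \<Sum>y | y \<in> C \<and> R a y. \<phi> a * \<theta> y)"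
      by (simp add: sum_distrib_left)
    also have "\<dots> = (\<Sum>y\<in>C. \<Sum>a | a \<in> C \<and> R a y. \<phi> a * \<theta> y)"
      by (rule sum.swap_restrict) (use C in auto)
    finally show ?thesis by (simp add: sum_distrib_left sym mult.commute)
  qed
  have "(\<Sum>a\<in>C. \<phi> a * (s a - sum \<theta> C))
      = (\<Sum>a\<in>C. \<phi> a * d a * \<theta> a) - (\<Sum>a\<in>C. \<phi> a * (\<Sum>y | y \<in> C \<and> R a y. \<theta> y))"
    by (simp add: \<theta>'[symmetric] algebra_simps sum_subtractf)
  also have "\<dots> = (\<Sum>a\<in>C. \<theta> a * (d a * \<phi> a - (\<Sum>y | y \<in> C \<and> R a y. \<phi> y)))"
    by (simp add: swap algebra_simps sum_subtractf)
  also have "\<dots> = sum \<theta> C" by (simp add: \<phi>)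
  finally have "(\<Sum>a\<in>C. \<phi> a * s a) - F * sum \<theta> C = sum \<theta> C"
    by (simp add: right_diff_distrib sum_subtractf F_def flip: sum_distrib_right)
  then have "(\<Sum>a\<in>C. \<phi> a * s a) = (1 + F) * sum \<theta> C" by (simp add: algebra_simps)
  moreover have "(\<Sum>a\<in>C. \<phi> a * s a) \<le> (\<Sum>a\<in>C. \<phi> a * \<kappa> + e a / gap)"
  proof (rule sum_mono)
    fix a assume a: "a \<in> C"
    have "\<phi> a * s a \<le> \<phi> a * (\<kappa> + e a)" using s[OF a] \<phi>0[OF a] by (rule mult_left_mono)
    also have "\<dots> \<le> \<phi> a * \<kappa> + e a / gap"
      using mult_right_mono[OF \<phi>1[OF a] e(1)[OF a]] by (simp add: algebra_simps)
    finally show "\<phi> a * s a \<le> \<phi> a * \<kappa> + e a / gap" .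
  qed
  moreover have "\<dots> = \<kappa> * F + sum e C / gap"
    by (simp add: sum.distrib F_def sum_distrib_left sum_divide_distrib mult.commute)
  moreover have "\<dots> \<le> \<kappa> * F + I / gap" using e gap by (simp add: divide_right_mono)
  ultimately have le: "(1 + F) * sum \<theta> C \<le> \<kappa> * F + I / gap" by linarith
  \<comment> \<open>As \<open>F \<ge> 1\<close>, the factor \<open>F / (1 + F)\<close> of
    \<open>\<kappa>\<close> lies between 1/2 and 1, and the factor \<open>1 / (1 + F)\<close> of
    \<open>I / gap\<close> is at most 1/2.\<close>
  define b where "b = (if \<kappa> \<ge> 0 then \<kappa> else \<kappa> / 2)"
  have b: "\<kappa> * F \<le> (1 + F) * b"
  proof (cases "\<kappa> \<ge> 0")
    case False
    then have "\<kappa> * F \<le> \<kappa>" using F1 mult_left_mono_neg[of 1 F \<kappa>] by simp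
    then show ?thesis using False by (simp add: b_def algebra_simps)
  qed (simp add: b_def algebra_simps)
  have "I \<ge> 0" using e(2) sum_nonneg[of C e] e(1) by force
  then have "2 * (I / (2 * gap)) \<le> (1 + F) * (I / (2 * gap))"
    using F1 gap by (intro mult_right_mono) auto
  then have "I / gap \<le> (1 + F) * (I / (2 * gap))" by simp
  then have "(1 + F) * sum \<theta> C \<le> (1 + F) * (b + I / (2 * gap))"
    using le b unfolding distrib_left by linarith
  then show ?thesis using F1 unfolding b_def by (simp add: mult_le_cancel_left)
qed

text \<open>The minimum principle gives \<open>- K / gap\<close> as a bound for all entries;
  inserting it into row \<open>x\<close> alone makes the loss proportional to the number of
  \<open>y\<close> with \<open>R x y\<close>.\<close>

lemma vertex_weight_lower_bound:
  fixes R :: "'a \<Rightarrow> 'a \<Rightarrow> bool" and s \<theta> :: "'a \<Rightarrow> real"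
  assumes C: "finite C" and gap: "gap > 0" and K: "K \<ge> 0"
    and R: "\<And>a. a \<in> C \<Longrightarrow> 2 * real (card {y\<in>C. R a y}) + gap \<le> real (card C)"
    and \<theta>: "\<And>a. a \<in> C \<Longrightarrow> (\<Sum>y | y \<in> C \<and> \<not> R a y. \<theta> a + \<theta> y) = s a"
    and s: "\<And>a. a \<in> C \<Longrightarrow> sum \<theta> C - K \<le> s a"
    and x: "x \<in> C"
  shows "s x - sum \<theta> C - real (card {y\<in>C. R x y}) * K / gap
    \<le> (real (card C) - real (card {y\<in>C. R x y})) * \<theta> x"
proof -
  define d where "d a = real (card C) - real (card {y\<in>C. R a y})" for a
  have d: "real (card {y\<in>C. R a y}) + gap \<le> d a" if "a \<in> C" for a
    using R[OF that] by (simp add: d_def)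
  have \<theta>': "d a * \<theta> a - (\<Sum>y | y \<in> C \<and> R a y. \<theta> y) = s a - sum \<theta> C" if "a \<in> C" for a
    using \<theta>[OF that] unfolding sum_pairs_complement[OF C(1)] d_def by simp
  have "- K \<le> d a * \<theta> a - (\<Sum>y | y \<in> C \<and> R a y. \<theta> y)" if "a \<in> C" for a
    using \<theta>'[OF that] s[OF that] by simp
  then have "- K / gap \<le> \<theta> y" if "y \<in> C" for y
    using diag_dominant_lower_bound[where R = R and d = d, OF C gap K d _ that] by blast
  then have "real (card {y\<in>C. R x y}) * (- K / gap) \<le> (\<Sum>y | y \<in> C \<and> R x y. \<theta> y)"
    using sum_bounded_below[of "{y\<in>C. R x y}" "- K / gap" \<theta>] by auto
  then show ?thesis using \<theta>'[OF x] by (simp add: d_def)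
qed

section \<open>Numerical estimates\<close>

text \<open>Cardinalities are in units of the number of vertices. The constant \<open>c = 1727/10000\<close> is an upper
  bound for \<open>1 - (7 + sqrt 21) / 14\<close>; \<open>6546\<close>, \<open>4819\<close> and \<open>3092\<close> come from \<open>1 - 2 * c\<close>, \<open>1 - 3 * c\<close> and
  \<open>1 - 4 * c\<close>. In \<open>local_estimate\<close>, \<open>A\<close>, \<open>v\<close>, \<open>X\<close> stand for the numbers of non-neighbours of the
  vertices \<open>u\<close>, \<open>v\<close>, \<open>x\<close> of a triangle, \<open>p\<close> and \<open>q\<close> for the numbers of common neighbours of \<open>u\<close>, \<open>x\<close> and
  of \<open>v\<close>, \<open>x\<close>, and \<open>j\<close> for the number of non-neighbours of \<open>x\<close> among those of \<open>u\<close>, \<open>v\<close>. The critical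
  case is \<open>A = v = X = c\<close>, \<open>p = 1 - c\<close>, \<open>j = 0\<close>.\<close>

lemma corner_estimate:
  fixes A p j :: real
  assumes A: "0 \<le> A" "A \<le> 1727/10000" and p: "6546/10000 \<le> p" "p \<le> 1 - A"
    and j: "0 \<le> j" "j \<le> 1 - p - A"
  defines "H \<equiv> (p - 1727/10000) / (2 * p^2) + 1 / p - 1 / (max (8273/10000) p - 1727/10000)"
  shows "H - (2626/100000 + A / 2) - j * ((34516/100000 + A / 2) / (4819/10000 - A)) \<ge> 0"
proof -
  \<comment> \<open>\<open>z\<close> and \<open>h\<close> measure how far \<open>A\<close> and
    \<open>p\<close> fall below \<open>1727/10000\<close> and \<open>8273/10000\<close>; together
    they bound \<open>j\<close>.\<close>
  define z where "z = 1727/10000 - A"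
  have z: "0 \<le> z" "z \<le> 1727/10000" using A by (auto simp: z_def)
  define h where "h = max 0 (8273/10000 - p)"
  have h0: "0 \<le> h" by (simp add: h_def)
  have jz: "j \<le> z + h" using j A p by (auto simp: z_def h_def)
  have p0: "p > 0" using p by simp
  have sum: "(p - 1727/10000) / (2 * p^2) + 1 / p = (3 * p - 1727/10000) / (2 * p^2)"
    using p0 by (simp add: field_simps power2_eq_square)
  \<comment> \<open>\<open>1593/10000\<close> is \<open>H\<close> at \<open>p = 8273/10000\<close>,
    rounded down. The slope \<open>18/10\<close> exceeds the rate \<open>r\<close> below, so the
    part \<open>h\<close> of \<open>j\<close> is paid for.\<close>
  have H: "H \<ge> 1593/10000 + 18/10 * h"
  proof (cases "p \<le> 8273/10000")
    case True
    have h: "p = 8273/10000 - h" "h \<le> 1727/10000" using True p by (auto simp: h_def)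
    have H': "H = (3 * p - 1727/10000) / (2 * p^2) - 10000/6546"
      using True unfolding H_def sum by simp
    have "(1593/10000 + 18/10 * h + 10000/6546) * (2 * p^2) \<le> 3 * p - 1727/10000"
    proof -
      have "h * h * h \<le> h * h * (1727/10000)" using h(2) by (rule mult_left_mono) simp
      moreover have "h * h * h \<le> h * h * 100" using h(2) by (intro mult_left_mono) auto
      ultimately show ?thesis using h0 unfolding h(1) by (simp add: algebra_simps power2_eq_square)
    qed
    then have "1593/10000 + 18/10 * h + 10000/6546 \<le> (3 * p - 1727/10000) / (2 * p^2)"
      using p by (simp add: pos_le_divide_eq)
    then show ?thesis unfolding H' by simp
  next
    case False
    have h: "h = 0" "p \<le> 1" using False p A by (auto simp: h_def)
    have H': "H = (3 * p - 1727/10000) / (2 * p^2) - 1 / (p - 1727/10000)"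
      using False unfolding H_def sum by simp
    have "1593/10000 * (2 * p^2 * (p - 1727/10000)) \<le> (3 * p - 1727/10000) * (p - 1727/10000) - 2 * p^2"
    proof -
      define k where "k = p - 8273/10000"
      have k: "0 \<le> k" "k \<le> 1727/10000" "p = 8273/10000 + k" using False h by (auto simp: k_def)
      have "k * k * k \<le> k * k * (1727/10000)" using k(2) by (rule mult_left_mono) simp
      moreover have "k * k * k \<le> k * k * 100" using k(2) by (intro mult_left_mono) auto
      ultimately show ?thesis using k(1) unfolding k(3)
        by (simp add: algebra_simps power2_eq_square add_divide_distrib)
    qed
    then have "1593/10000 \<le> ((3 * p - 1727/10000) * (p - 1727/10000) - 2 * p^2) / (2 * p^2 * (p - 1727/10000))"
      using p by (simp add: pos_le_divide_eq)
    also have "\<dots> = H"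
      unfolding H' using p by (simp add: diff_divide_distrib)
    finally show ?thesis using h by simp
  qed
  have g: "4819/10000 - A = 3092/10000 + z" by (simp add: z_def)
  have k: "34516/100000 + A / 2 = 43151/100000 - z / 2" by (simp add: z_def diff_divide_distrib)
  have A': "A = 1727/10000 - z" by (simp add: z_def)
  define r where "r = (43151/100000 - z / 2) / (3092/10000 + z)"
  have "j * r \<le> (z + h) * r"
    using jz z by (intro mult_right_mono) (auto simp: r_def)
  moreover have "h * r \<le> h * (18/10)"
    using h0 z by (intro mult_left_mono) (auto simp: r_def divide_simps)
  \<comment> \<open>The right-hand side is what \<open>1593/10000\<close> leaves after subtracting
    \<open>2626/100000 + A / 2\<close>. The square is centred near the minimum of the quadratic in
    \<open>z\<close> that has to be nonnegative.\<close>
  moreover have "z * r \<le> 4669/100000 + z / 2"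
  proof -
    have "0 \<le> (z - 115/1000)^2" by simp
    then have "z * (43151/100000 - z / 2) \<le> (4669/100000 + z / 2) * (3092/10000 + z)"
      using z by (simp add: power2_eq_square algebra_simps add_divide_distrib)
    then show ?thesis using z by (simp add: r_def pos_divide_le_eq)
  qed
  ultimately have "0 \<le> H - (2626/100000 + A / 2) - j * r"
    using H unfolding A' by (simp add: algebra_simps diff_divide_distrib)
  then show ?thesis unfolding g k r_def .
qed

text \<open>Reduction to \<open>v = 1727/10000\<close>, which is \<open>corner_estimate\<close>:
  lowering \<open>v\<close> by \<open>y\<close> raises the bound for \<open>\<Theta>\<close> by
  \<open>16818/10000 * y\<close>, but \<open>1 / q\<close> gains \<open>12/10 * y\<close> and
  \<open>(p - v) / (2 * p^2)\<close> gains \<open>y / 2\<close>.\<close>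

lemma local_estimate:
  fixes A v X p q j :: real
  assumes A: "0 \<le> A" "A \<le> 1727/10000" and v: "0 \<le> v" "v \<le> 1727/10000"
    and X: "X \<le> 1727/10000" "X \<le> 1 - p" and p: "6546/10000 \<le> p" "p \<le> 1 - A"
    and q: "1 - X - v \<le> q" and j: "0 \<le> j" "j \<le> 1 - p - A"
  defines "\<Theta> \<equiv> (if v \<le> A then (A - v) / (6546/10000)^2 else (A - v) / 2)
      + v * (1727/10000) / (6546/10000)^2 / (2 * (3092/10000))"
  defines "K \<equiv> \<Theta> + (1 / (8273/10000 - v) - 1 / (8273/10000))"
  shows "0 \<le> K"
    and "0 \<le> (p - v) / (2 * p^2) + 1 / p - 1 / q - \<Theta> - j * (K / (4819/10000 - A))"
proof -
  define y where "y = 1727/10000 - v"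
  have y: "0 \<le> y" "y \<le> 1727/10000" and v': "v = 1727/10000 - y" using v by (auto simp: y_def)
  have \<Theta>': "\<Theta> = (if v \<le> A then (A - v) / (6546/10000)^2 else (A - v) / 2)
      + v * (1727/10000 / (6546/10000)^2 / (2 * (3092/10000)))" by (simp add: \<Theta>_def)
  have "v / 2 \<le> v * (1727/10000 / (6546/10000)^2 / (2 * (3092/10000)))"
    using v by (simp add: power2_eq_square)
  moreover have "- v / 2 \<le> (if v \<le> A then (A - v) / (6546/10000)^2 else (A - v) / 2)"
    using A v by (auto intro: order_trans[of _ 0] simp: field_simps)
  ultimately have \<Theta>0: "0 \<le> \<Theta>" unfolding \<Theta>' by linarith
  have "v * (1727/10000 / (6546/10000)^2 / (2 * (3092/10000))) \<le> v * (652/1000)"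
    using v by (intro mult_left_mono) (auto simp: power2_eq_square)
  then have \<Theta>1: "\<Theta> \<le> 262504/10000000 + A / 2 + 16818/10000 * y"
    using A v unfolding \<Theta>' y_def by (auto simp: power2_eq_square field_simps)
  have "1 / (8273/10000) \<le> 1 / (8273/10000 - v)" using v by (intro divide_left_mono) auto
  then show K0: "0 \<le> K" using \<Theta>0 unfolding K_def by (intro add_nonneg_nonneg) (simp_all only: diff_ge_0_iff_ge)
  \<comment> \<open>A line just above the chord of \<open>1 / (6546/10000 + y)\<close>; its slope
    \<open>184/100\<close> exceeds \<open>16818/10000\<close>, so \<open>y\<close> drops out of the
    bound for \<open>K\<close>.\<close>
  have "0 \<le> y * (1727/10000 - y)" using y by simp
  then have "1 \<le> (152766/100000 - 184/100 * y) * (6546/10000 + y)"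
    using y by (simp add: algebra_simps)
  then have "1 / (6546/10000 + y) \<le> 152766/100000 - 184/100 * y"
    using y by (simp add: pos_divide_le_eq)
  moreover have "8273/10000 - v = 6546/10000 + y" by (simp add: y_def)
  ultimately have K1: "K \<le> 34516/100000 + A / 2" using \<Theta>1 y unfolding K_def by simp
  \<comment> \<open>Combines both upper bounds on \<open>X\<close> into
    \<open>m \<le> 1 - X\<close>, hence \<open>m - v \<le> q\<close>.\<close>
  define m where "m = max (8273/10000) p"
  have m: "8273/10000 \<le> m" "m \<le> 1" "m \<le> 1 - X" using p A X by (auto simp: m_def)
  have "1 / q \<le> 1 / (m - v)" using m q v by (intro divide_left_mono) auto
  also have "1 / (m - v) \<le> 1 / (m - 1727/10000) - 12/10 * y"
  proof -
    have "(m - 1727/10000) * (m - v) \<le> (8273/10000) * 1"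
      using m v by (intro mult_mono) auto
    then have "12/10 * y * ((m - 1727/10000) * (m - v)) \<le> 12/10 * y * (8273/10000)"
      using y by (intro mult_left_mono) auto
    also have "\<dots> \<le> y" using y by simp
    finally have "12/10 * y \<le> y / ((m - 1727/10000) * (m - v))"
      using m v by (simp add: pos_le_divide_eq)
    also have "\<dots> = 1 / (m - 1727/10000) - 1 / (m - v)"
      using m v by (subst diff_frac_eq) (auto simp: y_def)
    finally show ?thesis by simp
  qed
  finally have q': "1 / q \<le> 1 / (m - 1727/10000) - 12/10 * y" .
  have "p^2 \<le> 1" using p A by (simp add: power_le_one)
  then have "y * (2 * p^2) \<le> y * 2" using y by (intro mult_left_mono) auto
  then have "y / 2 \<le> y / (2 * p^2)" using p by (simp add: field_simps)
  then have p': "(p - 1727/10000) / (2 * p^2) + y / 2 \<le> (p - v) / (2 * p^2)"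
    by (simp add: v' diff_divide_distrib add_divide_distrib)
  have "j * (K / (4819/10000 - A)) \<le> j * ((34516/100000 + A / 2) / (4819/10000 - A))"
    using K1 A j by (intro mult_left_mono divide_right_mono) auto
  moreover note corner_estimate[OF A p j, folded m_def]
  ultimately show "0 \<le> (p - v) / (2 * p^2) + 1 / p - 1 / q - \<Theta> - j * (K / (4819/10000 - A))"
    using \<Theta>1 q' p' y by linarith
qed

section \<open>Graphs of large minimum degree\<close>

locale dense_graph =
  fixes V :: "'a set" and E :: "'a set set"
  assumes graph: "simple_graph V E" and nonempty: "V \<noteq> {}"
    and few_nonneighbours: "v \<in> V \<Longrightarrow> real (card {w\<in>V. {v, w} \<notin> E}) \<le> 1727/10000 * real (card V)"
begin

text \<open>Every vertex is its own non-neighbour, which makes all the estimates below exact in \<open>card V\<close>.\<close>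

definition nonnbrs :: "'a \<Rightarrow> 'a set" where
  "nonnbrs v = {w\<in>V. {v, w} \<notin> E}"

definition common :: "'a \<Rightarrow> 'a \<Rightarrow> 'a set" where
  "common u v = {x\<in>V. {u, x} \<in> E \<and> {v, x} \<in> E}"

text \<open>The function \<open>g\<close> of the overview: the triangles containing an edge
  \<open>uv\<close> correspond to the elements of \<open>common u v\<close>.\<close>

definition share :: "'a \<Rightarrow> 'a \<Rightarrow> real" where
  "share u v = 1 / real (card (common u v))"

section \<open>Counting non-neighbours and common neighbours\<close>

lemma finV: "finite V"
  using graph by (simp add: simple_graph_def)

lemma edgeD: "{u, v} \<in> E \<Longrightarrow> u \<in> V \<and> v \<in> V \<and> u \<noteq> v"
  using graph by (fastforce simp: simple_graph_def card_2_iff)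

lemma fin_common: "finite (common u v)" and fin_nonnbrs: "finite (nonnbrs u)"
  using finV by (auto simp: common_def nonnbrs_def)

lemma common_commute: "common u v = common v u"
  by (auto simp: common_def)

lemma share_commute: "share u v = share v u"
  by (simp add: share_def common_commute)

lemma order_pos: "real (card V) > 0"
  using nonempty finV by (simp add: card_gt_0_iff)

lemma card_nonnbrs: "v \<in> V \<Longrightarrow> real (card (nonnbrs v)) \<le> 1727/10000 * real (card V)"
  using few_nonneighbours by (simp add: nonnbrs_def)

lemma card_common_eq: "real (card (common u v)) = real (card V) - real (card (nonnbrs u \<union> nonnbrs v))"
proof -
  have "common u v = V - (nonnbrs u \<union> nonnbrs v)" "nonnbrs u \<union> nonnbrs v \<subseteq> V"
    by (auto simp: common_def nonnbrs_def)
  then show ?thesis using finV card_mono[of V "nonnbrs u \<union> nonnbrs v"]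
    by (simp add: card_Diff_subset finite_subset[of _ V] of_nat_diff del: Un_subset_iff)
qed

lemma card_common_eq': "real (card (common u v))
    = real (card V) - real (card (nonnbrs u)) - real (card (nonnbrs v)) + real (card (nonnbrs u \<inter> nonnbrs v))"
  using card_Un_Int[OF fin_nonnbrs[of u] fin_nonnbrs[of v]] by (simp add: card_common_eq)

lemma card_common_ge: "real (card V) - real (card (nonnbrs u)) - real (card (nonnbrs v)) \<le> real (card (common u v))"
  by (simp add: card_common_eq')

lemma card_common_le: "real (card (common u v)) \<le> real (card V) - real (card (nonnbrs u))"
    "real (card (common u v)) \<le> real (card V) - real (card (nonnbrs v))"
  using card_mono[of "nonnbrs u \<union> nonnbrs v" "nonnbrs u"] card_mono[of "nonnbrs u \<union> nonnbrs v" "nonnbrs v"]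
  by (auto simp: card_common_eq fin_nonnbrs)

lemma card_common_ge': "u \<in> V \<Longrightarrow> v \<in> V \<Longrightarrow> 6546/10000 * real (card V) \<le> real (card (common u v))"
  using card_common_ge[of u v] card_nonnbrs[of u] card_nonnbrs[of v] by simp

lemma card_common_pos: "u \<in> V \<Longrightarrow> v \<in> V \<Longrightarrow> 0 < real (card (common u v))"
  using card_common_ge'[of u v] order_pos by linarith

text \<open>Double counting: each \<open>z\<close> in \<open>nonnbrs v\<close> is a non-neighbour of
  at most \<open>1727/10000 * card V\<close> vertices \<open>a\<close>. This is the averaging over
  \<open>x\<close> of the overview.\<close>

lemma sum_card_nonnbrs_Int:
  assumes "v \<in> V" "C \<subseteq> V"
  shows "(\<Sum>a\<in>C. real (card (nonnbrs v \<inter> nonnbrs a)))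
    \<le> real (card (nonnbrs v)) * (1727/10000 * real (card V))"
proof -
  have fC: "finite C" using assms finV finite_subset by blast
  have "(\<Sum>a\<in>C. card (nonnbrs v \<inter> nonnbrs a)) = (\<Sum>a\<in>C. \<Sum>z\<in>nonnbrs v. if z \<in> nonnbrs a then 1 else 0)"
    by (simp add: sum.If_cases fin_nonnbrs Int_def)
  also have "\<dots> = (\<Sum>z\<in>nonnbrs v. \<Sum>a\<in>C. if z \<in> nonnbrs a then 1 else 0)"
    by (rule sum.swap)
  also have "\<dots> = (\<Sum>z\<in>nonnbrs v. card {a\<in>C. z \<in> nonnbrs a})"
    by (simp add: sum.If_cases fC Int_def)
  also have "\<dots> \<le> (\<Sum>z\<in>nonnbrs v. card (nonnbrs z))"
    using assms by (intro sum_mono card_mono) (auto simp: nonnbrs_def insert_commute finV)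
  finally have "(\<Sum>a\<in>C. real (card (nonnbrs v \<inter> nonnbrs a))) \<le> (\<Sum>z\<in>nonnbrs v. real (card (nonnbrs z)))"
    by (simp flip: of_nat_sum)
  also have "\<dots> \<le> real (card (nonnbrs v)) * (1727/10000 * real (card V))"
    using card_nonnbrs by (intro sum_bounded_above) (auto simp: nonnbrs_def)
  finally show ?thesis .
qed

text \<open>A triangle containing \<open>u\<close> and \<open>x\<close> lies in at most \<open>card (common u x)\<close> copies of \<open>K\<^sub>4\<close>, so losing
  \<open>1 / (2 * (card (common u x))\<^sup>2)\<close> in each of them uses up at most half of \<open>share u x\<close>.\<close>

lemma swap_weight_lower_bound:
  assumes u: "u \<in> V" and v: "v \<in> V" and x: "x \<in> common u v"
    and \<theta>: "\<And>a. a \<in> common u v \<Longrightarrow>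
      (\<Sum>y | y \<in> common u v \<and> \<not> {a, y} \<notin> E. \<theta> a + \<theta> y) = share u a - share v a"
  shows "- 1 / (2 * (real (card (common u x)))\<^sup>2) \<le> \<theta> x"
proof -
  define n where "n = real (card V)"
  have n: "n > 0" using order_pos by (simp add: n_def)
  define C where "C = common u v"
  have CV: "C \<subseteq> V" and fC: "finite C" using finV by (auto simp: C_def common_def)
  have xV: "x \<in> V" using x by (simp add: common_def)
  define A where "A = real (card (nonnbrs u)) / n"
  define b where "b = real (card (nonnbrs v)) / n"
  have A: "0 \<le> A" "A \<le> 1727/10000" "real (card (nonnbrs u)) = A * n"
    using card_nonnbrs[OF u] n by (auto simp: A_def n_def[symmetric] field_simps)
  have b: "0 \<le> b" "b \<le> 1727/10000" "real (card (nonnbrs v)) = b * n"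
    using card_nonnbrs[OF v] n by (auto simp: b_def n_def[symmetric] field_simps)
  have c: "real (card (nonnbrs a)) \<le> 1727/10000 * n" if "a \<in> V" for a
    using card_nonnbrs[OF that] by (simp add: n_def)
  have tC: "(1 - A - b) * n \<le> real (card C)"
    using card_common_ge[of u v] A b by (simp add: C_def n_def[symmetric] algebra_simps)
  have R: "real (card {y\<in>C. {a, y} \<notin> E}) \<le> 1727/10000 * n" if "a \<in> C" for a
  proof -
    have "card {y\<in>C. {a, y} \<notin> E} \<le> card (nonnbrs a)"
      using CV finV by (intro card_mono) (auto simp: nonnbrs_def)
    then show ?thesis using c[of a] that CV by force
  qed
  have "0 < (1 - A - b) * n" using A b n by simp
  then have C0: "C \<noteq> {}" using tC by auto
  \<comment> \<open>\<open>\<Theta> / n\<close> will bound \<open>sum \<theta> C\<close>. In the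
    right-hand side, \<open>\<kappa>\<close> comes from the different numbers of non-neighbours of
    \<open>u\<close> and \<open>v\<close>, and \<open>e a\<close> from the common non-neighbours of
    \<open>v\<close> and \<open>a\<close>.\<close>
  define \<Theta> where "\<Theta> = (if b \<le> A then (A - b) / (6546/10000)^2 else (A - b) / 2)
      + b * (1727/10000) / (6546/10000)^2 / (2 * (3092/10000))"
  define \<kappa> where "\<kappa> = (if b \<le> A then (A - b) / (6546/10000)^2 else A - b) / n"
  define e where "e a = real (card (nonnbrs v \<inter> nonnbrs a)) / (6546/10000 * n)^2" for a
  have s_upper: "share u a - share v a \<le> \<kappa> + e a" if "a \<in> C" for a
  proof -
    have a: "a \<in> V" using that CV by blast
    define t where "t = real (card (common u a))"
    define t' where "t' = real (card (common v a))"
    have t: "6546/10000 * n \<le> t" "t \<le> n" and t': "6546/10000 * n \<le> t'" "t' \<le> n"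
      using card_common_ge'[OF u a] card_common_ge'[OF v a] card_common_le(1)[of u a] card_common_le(1)[of v a]
      by (auto simp: t_def t'_def n_def)
    have tt0: "t > 0" "t' > 0" using t t' n by linarith+
    have "(6546/10000 * n) * (6546/10000 * n) \<le> t * t'" "t * t' \<le> n * n"
      using t t' n tt0 by (intro mult_mono; linarith)+
    then have tt: "(6546/10000 * n)^2 \<le> t * t'" "t * t' \<le> n^2" "t > 0" "t' > 0"
      using tt0 by (simp_all only: power2_eq_square)
    \<comment> \<open>Inclusion-exclusion; the common non-neighbours of \<open>u\<close> and
      \<open>a\<close> enter negatively and are dropped.\<close>
    have "t' - t \<le> (A - b) * n + real (card (nonnbrs v \<inter> nonnbrs a))"
      using A b unfolding t_def t'_def card_common_eq' by (simp add: algebra_simps)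
    then have "(t' - t) / (t * t') \<le> ((A - b) * n + real (card (nonnbrs v \<inter> nonnbrs a))) / (t * t')"
      using tt by (intro divide_right_mono) auto
    also have "\<dots> = (A - b) * n / (t * t') + real (card (nonnbrs v \<inter> nonnbrs a)) / (t * t')"
      by (rule add_divide_distrib)
    also have "\<dots> \<le> \<kappa> + e a"
    proof (rule add_mono)
      have n2: "(6546/10000 * n)^2 > 0" using n by simp
      show "real (card (nonnbrs v \<inter> nonnbrs a)) / (t * t') \<le> e a"
        unfolding e_def using tt n2 by (intro divide_left_mono) auto
      \<comment> \<open>The sign of \<open>A - b\<close> decides whether the lower or the upper
        bound on \<open>t * t'\<close> is the right one.\<close>
      show "(A - b) * n / (t * t') \<le> \<kappa>"
      proof (cases "b \<le> A")
        case True
        then have "(A - b) * n / (t * t') \<le> (A - b) * n / (6546/10000 * n)^2"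
          using tt n2 n by (intro divide_left_mono) auto
        also have "\<dots> = \<kappa>" using True n by (simp add: \<kappa>_def power2_eq_square)
        finally show ?thesis .
      next
        case False
        then have "(A - b) * n / (t * t') \<le> (A - b) * n / n^2"
          using tt n by (intro divide_left_mono_neg) (auto simp: mult_nonpos_nonneg)
        also have "\<dots> = \<kappa>" using False n by (simp add: \<kappa>_def power2_eq_square)
        finally show ?thesis .
      qed
    qed
    also have "(t' - t) / (t * t') = share u a - share v a"
      using tt by (simp add: share_def t_def[symmetric] t'_def[symmetric] field_simps)
    finally show ?thesis .
  qed
  define I where "I = b * (1727/10000) / (6546/10000)^2"
  have "sum e C = (\<Sum>a\<in>C. real (card (nonnbrs v \<inter> nonnbrs a))) / (6546/10000 * n)^2"
    by (simp add: e_def sum_divide_distrib)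
  also have "\<dots> \<le> b * n * (1727/10000 * n) / (6546/10000 * n)^2"
    using sum_card_nonnbrs_Int[OF v CV] unfolding b(3) n_def[symmetric] by (intro divide_right_mono) auto
  also have "\<dots> = I" using n by (simp add: I_def power2_eq_square)
  finally have e_sum: "sum e C \<le> I" .
  have sum\<theta>: "sum \<theta> C \<le> \<Theta> / n"
  proof -
    have "sum \<theta> C \<le> (if \<kappa> \<ge> 0 then \<kappa> else \<kappa> / 2) + I / (2 * (3092/10000 * n))"
    proof (rule sum_vertex_weights_le[where R = "\<lambda>a y. {a, y} \<notin> E" and e = e, OF fC C0])
      \<comment> \<open>The gap is \<open>6546/10000 - 2 * (1727/10000)\<close>.\<close>
      show "2 * real (card {y\<in>C. {a, y} \<notin> E}) + 3092/10000 * n \<le> real (card C)" if "a \<in> C" for a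
      proof -
        have "(1 - A - b) * n \<ge> (6546/10000) * n" using A b n by (intro mult_right_mono) auto
        then show ?thesis using R[OF that] tC by linarith
      qed
      show "0 \<le> e a" for a by (simp add: e_def)
    qed (use n s_upper e_sum \<theta> in \<open>auto simp: C_def insert_commute\<close>)
    also have "(if \<kappa> \<ge> 0 then \<kappa> else \<kappa> / 2)
        = (if b \<le> A then (A - b) / (6546/10000)^2 else (A - b) / 2) / n"
      using n by (auto simp: \<kappa>_def field_simps)
    also have "\<dots> + I / (2 * (3092/10000 * n)) = \<Theta> / n"
      using n by (simp add: \<Theta>_def I_def add_divide_distrib)
    finally show ?thesis .
  qed
  define p where "p = real (card (common u x)) / n"
  define q where "q = real (card (common v x)) / n"
  define X where "X = real (card (nonnbrs x)) / n"
  define j where "j = real (card {y\<in>C. {x, y} \<notin> E}) / n"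
  define D where "D = real (card C) - real (card {y\<in>C. {x, y} \<notin> E})"
  \<comment> \<open>\<open>K / n\<close> bounds
    \<open>sum \<theta> C - (share u a - share v a)\<close>: the bracket is the worst case of
    \<open>n * (share v a - share u a)\<close>, with \<open>1727/10000 * n\<close> non-neighbours of
    \<open>a\<close>.\<close>
  define K where "K = \<Theta> + (1 / (8273/10000 - b) - 1 / (8273/10000))"
  have p: "6546/10000 \<le> p" "p \<le> 1 - A" "real (card (common u x)) = p * n"
    using card_common_ge'[OF u xV] card_common_le(1)[of u x] A n
    by (auto simp: p_def n_def[symmetric] field_simps)
  have X: "X \<le> 1727/10000" "X \<le> 1 - p" "real (card (nonnbrs x)) = X * n"
    using card_common_le(2)[of u x] c[OF xV] n by (auto simp: p_def X_def n_def[symmetric] field_simps)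
  have q: "1 - X - b \<le> q" "real (card (common v x)) = q * n"
    using card_common_ge[of v x] b X n by (auto simp: q_def n_def[symmetric] field_simps)
  have j: "0 \<le> j" "j \<le> 1 - p - A" "real (card {y\<in>C. {x, y} \<notin> E}) = j * n"
  proof -
    \<comment> \<open>Non-neighbours of \<open>x\<close> in \<open>C\<close> are neighbours of
      \<open>u\<close>, so both kinds of vertices are missing from \<open>common u x\<close> without
      overlap.\<close>
    have CuN: "nonnbrs u \<inter> C = {}" by (auto simp: nonnbrs_def C_def common_def)
    have "card (nonnbrs u \<union> {y\<in>C. {x, y} \<notin> E}) \<le> card (nonnbrs u \<union> nonnbrs x)"
      using fin_nonnbrs CV by (intro card_mono) (auto simp: nonnbrs_def)
    moreover have "card (nonnbrs u \<union> {y\<in>C. {x, y} \<notin> E}) = card (nonnbrs u) + card {y\<in>C. {x, y} \<notin> E}"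
      by (rule card_Un_disjoint) (use fC fin_nonnbrs CuN in auto)
    ultimately have "real (card (nonnbrs u)) + real (card {y\<in>C. {x, y} \<notin> E}) \<le> n - real (card (common u x))"
      unfolding card_common_eq n_def by simp
    then show "j \<le> 1 - p - A" using n A p by (simp add: j_def field_simps)
  qed (use n in \<open>auto simp: j_def\<close>)
  \<comment> \<open>\<open>D\<close> counts the common neighbours of \<open>u\<close>,
    \<open>v\<close> and \<open>x\<close>.\<close>
  have D: "(p - b) * n \<le> D"
  proof -
    have eq: "common u x - nonnbrs v = C - {y\<in>C. {x, y} \<notin> E}"
      by (auto simp: C_def common_def nonnbrs_def)
    have "card (common u x - nonnbrs v) = card C - card {y\<in>C. {x, y} \<notin> E}"
      unfolding eq using fC by (intro card_Diff_subset) auto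
    moreover have "card {y\<in>C. {x, y} \<notin> E} \<le> card C" using fC by (intro card_mono) auto
    moreover have "card (common u x) - card (nonnbrs v) \<le> card (common u x - nonnbrs v)"
      by (rule diff_card_le_card_Diff) (rule fin_nonnbrs)
    ultimately have "card (common u x) + card {y\<in>C. {x, y} \<notin> E} \<le> card C + card (nonnbrs v)"
      by linarith
    then have "real (card (common u x)) - real (card (nonnbrs v)) \<le> D"
      unfolding D_def by linarith
    then show ?thesis using p b by (simp add: algebra_simps)
  qed
  have "0 < (p - b) * n" using p b n by simp
  then have D0: "D > 0" using D by linarith
  note est = local_estimate[OF A(1,2) b(1,2) X(1,2) p(1,2) q(1) j(1,2), folded \<Theta>_def, folded K_def]
  \<comment> \<open>This gap keeps the dependence on \<open>A\<close> and bounds only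
    \<open>b\<close> by \<open>1727/10000\<close>.\<close>
  have "share u x - share v x - sum \<theta> C - real (card {y\<in>C. {x, y} \<notin> E}) * (K / n) / ((4819/10000 - A) * n) \<le> D * \<theta> x"
    unfolding D_def
  proof (rule vertex_weight_lower_bound[where R = "\<lambda>a y. {a, y} \<notin> E" and s = "\<lambda>a. share u a - share v a"
        and gap = "(4819/10000 - A) * n" and K = "K / n" and C = C and \<theta> = \<theta> and x = x, OF fC])
    show "0 < (4819/10000 - A) * n" using A n by simp
    show "0 \<le> K / n" using est(1) n by simp
    show "2 * real (card {y\<in>C. {a, y} \<notin> E}) + (4819/10000 - A) * n \<le> real (card C)" if "a \<in> C" for a
    proof -
      have "(8273/10000 - A) * n \<le> (1 - A - b) * n" using b n by (intro mult_right_mono) auto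
      then show ?thesis using R[OF that] tC by (simp add: algebra_simps)
    qed
    show "sum \<theta> C - K / n \<le> share u a - share v a" if "a \<in> C" for a
    proof -
      have a: "a \<in> V" using that CV by blast
      define Y where "Y = real (card (nonnbrs a)) / n"
      have Y: "0 \<le> Y" "Y \<le> 1727/10000" "real (card (nonnbrs a)) = Y * n"
        using c[OF a] n by (auto simp: Y_def field_simps)
      have "real (card (common u a)) \<le> (1 - Y) * n" "(1 - b - Y) * n \<le> real (card (common v a))"
        using card_common_le(2)[of u a] card_common_ge[of v a] Y b by (auto simp: n_def[symmetric] algebra_simps)
      moreover have "0 < (1 - b - Y) * n" using b Y n by simp
      ultimately have "1 / ((1 - Y) * n) \<le> share u a" "share v a \<le> 1 / ((1 - b - Y) * n)"
        using card_common_pos[OF u a] n Y unfolding share_def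
        by (auto intro!: divide_left_mono)
      moreover have "1 / (1 - b - Y) - 1 / (1 - Y) \<le> 1 / (8273/10000 - b) - 1 / (8273/10000)"
      proof -
        have "1 / (1 - b - Y) - 1 / (1 - Y) = b / ((1 - b - Y) * (1 - Y))"
          using b Y by (subst diff_frac_eq) auto
        also have "\<dots> \<le> b / ((8273/10000 - b) * (8273/10000))"
          using b Y by (intro divide_left_mono mult_mono) auto
        also have "\<dots> = 1 / (8273/10000 - b) - 1 / (8273/10000)"
          using b by (subst diff_frac_eq) auto
        finally show ?thesis .
      qed
      then have "(1 / (1 - b - Y) - 1 / (1 - Y)) / n \<le> (1 / (8273/10000 - b) - 1 / (8273/10000)) / n"
        using n by (intro divide_right_mono) auto
      ultimately show ?thesis
        using sum\<theta> unfolding K_def add_divide_distrib diff_divide_distrib divide_divide_eq_left by linarith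
    qed
  qed (use \<theta> x in \<open>auto simp: C_def\<close>)
  moreover have "real (card {y\<in>C. {x, y} \<notin> E}) * (K / n) / ((4819/10000 - A) * n) = j * (K / (4819/10000 - A)) / n"
    unfolding j(3) using n by simp
  moreover have "share u x - share v x = (1 / p - 1 / q) / n"
    by (simp add: share_def p(3) q(2) diff_divide_distrib)
  ultimately have "(1 / p - 1 / q - \<Theta> - j * (K / (4819/10000 - A))) / n \<le> D * \<theta> x"
    using sum\<theta> unfolding diff_divide_distrib by linarith
  moreover have "- ((p - b) / (2 * p^2)) / n \<le> (1 / p - 1 / q - \<Theta> - j * (K / (4819/10000 - A))) / n"
    using est(2) n by (intro divide_right_mono) auto
  moreover have "D * (- 1 / (2 * (p * n)^2)) \<le> - ((p - b) / (2 * p^2)) / n"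
  proof -
    have "(p - b) / (2 * p^2) / n = (p - b) * n / (2 * (p * n)^2)"
      using n by (simp add: power2_eq_square)
    also have "\<dots> \<le> D / (2 * (p * n)^2)" using D by (intro divide_right_mono) auto
    finally show ?thesis by simp
  qed
  ultimately have "D * (- 1 / (2 * (p * n)^2)) \<le> D * \<theta> x" by linarith
  then show ?thesis using D0 unfolding p(3) by (simp only: mult_le_cancel_left_pos)
qed

section \<open>Antisymmetric swap weights\<close>

lemma swap_weights:
  obtains \<theta> :: "'a \<Rightarrow> 'a \<Rightarrow> 'a \<Rightarrow> real" where
    "\<And>u v x. \<lbrakk>u \<in> V; v \<in> V; x \<in> common u v\<rbrakk> \<Longrightarrow>
      (\<Sum>y | y \<in> common u v \<and> {x, y} \<in> E. \<theta> u v x + \<theta> u v y) = share u x - share v x"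
    and "\<And>u v x. \<theta> v u x = - \<theta> u v x"
    and "\<And>u v x. \<lbrakk>u \<in> V; v \<in> V; x \<in> common u v\<rbrakk> \<Longrightarrow>
      - 1 / (2 * (real (card (common u x)))\<^sup>2) \<le> \<theta> u v x"
proof -
  define P where "P u v \<theta> \<longleftrightarrow> (u \<in> V \<longrightarrow> v \<in> V \<longrightarrow> (\<forall>x\<in>common u v.
      (\<Sum>y | y \<in> common u v \<and> \<not> {x, y} \<notin> E. \<theta> x + \<theta> y) = share u x - share v x))"
    for u v and \<theta> :: "'a \<Rightarrow> real"
  have ex: "\<exists>\<theta>. P u v \<theta>" for u v
  proof (cases "u \<in> V \<and> v \<in> V")
    case True
    show ?thesis
    proof (rule edge_weights_with_vertex_sums[where C = "common u v" and R = "\<lambda>a y. {a, y} \<notin> E"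
          and s = "\<lambda>x. share u x - share v x" and gap = "3092/10000 * real (card V)"])
      show "2 * real (card {y\<in>common u v. {a, y} \<notin> E}) + 3092/10000 * real (card V) \<le> real (card (common u v))"
        if "a \<in> common u v" for a
      proof -
        have "card {y\<in>common u v. {a, y} \<notin> E} \<le> card (nonnbrs a)"
          by (intro card_mono fin_nonnbrs) (auto simp: nonnbrs_def common_def)
        moreover have "a \<in> V" using that by (simp add: common_def)
        ultimately show ?thesis
          using card_nonnbrs[of a] card_common_ge'[of u v] True by linarith
      qed
    next
      fix \<theta>
      assume "\<And>a. a \<in> common u v \<Longrightarrow>
        (\<Sum>y | y \<in> common u v \<and> \<not> {a, y} \<notin> E. \<theta> a + \<theta> y) = share u a - share v a"
      then show ?thesis unfolding P_def by blast
    qed (use order_pos in \<open>simp_all add: fin_common\<close>)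
  qed (auto simp: P_def)
  define \<theta> where "\<theta> u v = (SOME \<theta>. P u v \<theta>)" for u v
  have "P u v (\<theta> u v)" for u v
    unfolding \<theta>_def using ex by (rule someI_ex)
  then have \<theta>: "(\<Sum>y | y \<in> common u v \<and> \<not> {x, y} \<notin> E. \<theta> u v x + \<theta> u v y) = share u x - share v x"
    if "u \<in> V" "v \<in> V" "x \<in> common u v" for u v x
    using that unfolding P_def by blast
  \<comment> \<open>The right-hand side changes sign when \<open>u\<close> and \<open>v\<close> are
    exchanged, so the antisymmetrised weights solve the same system;
    \<open>swap_weight_lower_bound\<close> applies to any solution.\<close>
  define \<eta> where "\<eta> u v x = (\<theta> u v x - \<theta> v u x) / 2" for u v x
  have eq: "(\<Sum>y | y \<in> common u v \<and> \<not> {x, y} \<notin> E. \<eta> u v x + \<eta> u v y) = share u x - share v x"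
    if "u \<in> V" "v \<in> V" "x \<in> common u v" for u v x
  proof -
    have "(\<Sum>y | y \<in> common u v \<and> \<not> {x, y} \<notin> E. \<eta> u v x + \<eta> u v y)
        = ((\<Sum>y | y \<in> common u v \<and> \<not> {x, y} \<notin> E. \<theta> u v x + \<theta> u v y)
          - (\<Sum>y | y \<in> common v u \<and> \<not> {x, y} \<notin> E. \<theta> v u x + \<theta> v u y)) / 2"
      unfolding \<eta>_def common_commute[of v u] sum_subtractf[symmetric] sum_divide_distrib
      by (intro sum.cong) (auto simp: field_simps)
    also have "\<dots> = share u x - share v x"
      using \<theta>[of u v x] \<theta>[of v u x] that by (simp add: common_commute)
    finally show ?thesis .
  qed
  show ?thesis
  proof (rule that[of \<eta>])
    show "- 1 / (2 * (real (card (common u x)))\<^sup>2) \<le> \<eta> u v x"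
      if "u \<in> V" "v \<in> V" "x \<in> common u v" for u v x
      using swap_weight_lower_bound[OF that, of "\<eta> u v"] eq that by blast
    show "\<eta> v u x = - \<eta> u v x" for u v x by (simp add: \<eta>_def field_simps)
  qed (use eq in simp)
qed

section \<open>Triangle weights and extensions of triangles to \<open>K_4\<close>\<close>

definition common3 :: "'a set \<Rightarrow> 'a set" where
  "common3 T = {v\<in>V. \<forall>a\<in>T. {a, v} \<in> E}"

lemma triangles_containing:
  assumes e: "{a, b} \<in> E"
  shows "{T. T \<in> triangles V E \<and> {a, b} \<subseteq> T} = (\<lambda>y. {a, b, y}) ` common a b"
proof (intro equalityI subsetI)
  fix T assume "T \<in> {T. T \<in> triangles V E \<and> {a, b} \<subseteq> T}"
  then have T: "T \<subseteq> V" "card T = 3" "\<And>e. e \<subseteq> T \<Longrightarrow> card e = 2 \<Longrightarrow> e \<in> E" "a \<in> T" "b \<in> T"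
    by (auto simp: triangles_def)
  have ab: "a \<noteq> b" using edgeD[OF e] by simp
  have "finite T" using T finV finite_subset by blast
  then have "card (T - {a, b}) = 1" using T ab by (subst card_Diff_subset) auto
  then obtain y where y: "T - {a, b} = {y}" by (auto simp: card_1_singleton_iff)
  then have Ty: "T = {a, b, y}" "y \<noteq> a" "y \<noteq> b" using T by auto
  then have "{a, y} \<in> E" "{b, y} \<in> E" using T by auto
  then have "y \<in> common a b" using T Ty by (auto simp: common_def)
  then show "T \<in> (\<lambda>y. {a, b, y}) ` common a b" using Ty by blast
next
  fix T assume "T \<in> (\<lambda>y. {a, b, y}) ` common a b"
  then obtain y where y: "T = {a, b, y}" "y \<in> V" "{a, y} \<in> E" "{b, y} \<in> E" by (auto simp: common_def)
  have d: "a \<noteq> b" "a \<noteq> y" "b \<noteq> y" "a \<in> V" "b \<in> V" using edgeD[OF e] edgeD[OF y(3)] edgeD[OF y(4)] by auto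
  have "f \<in> E" if f: "f \<subseteq> T" "card f = 2" for f
  proof -
    obtain p q where pq: "f = {p, q}" "p \<noteq> q" using f(2) by (auto simp: card_2_iff)
    then show ?thesis using f(1) e y by (auto simp: insert_commute)
  qed
  then show "T \<in> {T. T \<in> triangles V E \<and> {a, b} \<subseteq> T}"
    using y d by (auto simp: triangles_def)
qed

lemma fractional_decomposition: "\<exists>w. fractional_triangle_decomposition V E w"
proof -
  obtain \<theta> where sys: "\<And>u v x. \<lbrakk>u \<in> V; v \<in> V; x \<in> common u v\<rbrakk> \<Longrightarrow>
      (\<Sum>y | y \<in> common u v \<and> {x, y} \<in> E. \<theta> u v x + \<theta> u v y) = share u x - share v x"
    and anti: "\<And>u v x. \<theta> v u x = - \<theta> u v x"
    and lower: "\<And>u v x. \<lbrakk>u \<in> V; v \<in> V; x \<in> common u v\<rbrakk> \<Longrightarrow>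
      - 1 / (2 * (real (card (common u x)))\<^sup>2) \<le> \<theta> u v x"
    using swap_weights by blast
  \<comment> \<open>The sum runs over ordered pairs, so each edge contributes its full
    \<open>share\<close>. For fixed \<open>u\<close> and \<open>v\<close>, the two values of
    \<open>x\<close> give \<open>3 * m\<close>; the subtraction from the triangles at
    \<open>v\<close> is the antisymmetry of \<open>\<theta>\<close>.\<close>
  define w where "w T = (\<Sum>u\<in>T. \<Sum>x\<in>T - {u}. share u x / 2 + (\<Sum>v\<in>common3 T. \<theta> u v x)) / 3" for T
  have nonneg: "0 \<le> w T" if T: "T \<in> triangles V E" for T
  proof -
    have "0 \<le> share u x / 2 + (\<Sum>v\<in>common3 T. \<theta> u v x)" if "u \<in> T" "x \<in> T - {u}" for u x
    proof -
      have uV: "u \<in> V" and xV: "x \<in> V" and "card {u, x} = 2" "{u, x} \<subseteq> T"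
        using T that by (auto simp: triangles_def)
      then have ux: "{u, x} \<in> E" using T by (auto simp: triangles_def)
      define t where "t = real (card (common u x))"
      have t: "t > 0" using card_common_pos[OF uV xV] by (simp add: t_def)
      have "card (common3 T) \<le> card (common u x)"
        using that by (intro card_mono fin_common) (auto simp: common3_def common_def)
      then have ct: "real (card (common3 T)) \<le> t" by (simp add: t_def)
      have "- 1 / (2 * t\<^sup>2) \<le> \<theta> u v x" if v: "v \<in> common3 T" for v
      proof -
        have "{u, v} \<in> E" "{x, v} \<in> E" "v \<in> V" using v \<open>u \<in> T\<close> \<open>x \<in> T - {u}\<close> by (auto simp: common3_def)
        then have "x \<in> common u v" using ux xV by (auto simp: common_def insert_commute)
        then show ?thesis using lower[OF uV \<open>v \<in> V\<close>] by (simp add: t_def)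
      qed
      then have "real (card (common3 T)) * (- 1 / (2 * t\<^sup>2)) \<le> (\<Sum>v\<in>common3 T. \<theta> u v x)"
        using sum_bounded_below[of "common3 T" "- 1 / (2 * t\<^sup>2)"] by auto
      moreover have "t * (- 1 / (2 * t\<^sup>2)) \<le> real (card (common3 T)) * (- 1 / (2 * t\<^sup>2))"
        using ct by (intro mult_right_mono_neg) auto
      moreover have "t * (- 1 / (2 * t\<^sup>2)) = - share u x / 2"
        using t by (simp add: share_def t_def[symmetric] power2_eq_square)
      ultimately show ?thesis by linarith
    qed
    then show ?thesis unfolding w_def by (intro divide_nonneg_pos sum_nonneg) auto
  qed
  have load: "(\<Sum>T | T \<in> triangles V E \<and> {a, b} \<subseteq> T. w T) = 1" if e: "{a, b} \<in> E" for a b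
  proof -
    define C where "C = common a b"
    have fC: "finite C" by (simp add: C_def fin_common)
    have ab: "a \<in> V" "b \<in> V" "a \<noteq> b" using edgeD[OF e] by auto
    have yC: "y \<in> V \<and> {a, y} \<in> E \<and> {b, y} \<in> E \<and> y \<noteq> a \<and> y \<noteq> b" if "y \<in> C" for y
      using that edgeD[of a y] edgeD[of b y] by (auto simp: C_def common_def)
    \<comment> \<open>A \<open>K_4\<close> containing \<open>ab\<close> is given by \<open>y\<close>
      and \<open>v\<close> in \<open>C\<close> with \<open>v \<in> L y\<close>.\<close>
    define L where "L y = {v\<in>C. {y, v} \<in> E}" for y
    have fL: "finite (L y)" for y using fC by (simp add: L_def)
    have c3: "common3 {a, b, y} = L y" for y
      by (auto simp: common3_def L_def C_def common_def)
    have Lsym: "v \<in> L y \<longleftrightarrow> y \<in> L v" if "v \<in> C" "y \<in> C" for v y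
      using that by (auto simp: L_def insert_commute)
    have w: "3 * w {a, b, y} = share a b + share a y + share b y
        + (\<Sum>v\<in>L y. (\<theta> a v b + \<theta> a v y) + (\<theta> b v a + \<theta> b v y) + (\<theta> y v a + \<theta> y v b))"
      if "y \<in> C" for y
    proof -
      have "{a, b, y} - {a} = {b, y}" "{a, b, y} - {b} = {a, y}" "{a, b, y} - {y} = {a, b}"
        using yC[OF that] ab by auto
      moreover have sum3: "(\<Sum>u\<in>{a, b, y}. f u) = f a + f b + f y" for f :: "'a \<Rightarrow> real"
        using yC[OF that] ab by auto
      ultimately have "3 * w {a, b, y} = (share a b / 2 + (\<Sum>v\<in>L y. \<theta> a v b)) + (share a y / 2 + (\<Sum>v\<in>L y. \<theta> a v y))
        + ((share b a / 2 + (\<Sum>v\<in>L y. \<theta> b v a)) + (share b y / 2 + (\<Sum>v\<in>L y. \<theta> b v y)))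
        + ((share y a / 2 + (\<Sum>v\<in>L y. \<theta> y v a)) + (share y b / 2 + (\<Sum>v\<in>L y. \<theta> y v b)))"
        using yC[OF that] ab not_sym[of y a] not_sym[of y b] unfolding w_def c3 sum3 by simp
      then show ?thesis
        by (simp add: sum.distrib share_commute[of b a] share_commute[of y a] share_commute[of y b])
    qed
    have swap: "(\<Sum>y\<in>C. \<Sum>v\<in>L y. f y v) = (\<Sum>v\<in>C. \<Sum>y\<in>L v. f y v)" for f :: "'a \<Rightarrow> 'a \<Rightarrow> real"
    proof -
      have "(\<Sum>y\<in>C. \<Sum>v | v \<in> C \<and> {y, v} \<in> E. f y v) = (\<Sum>v\<in>C. \<Sum>y | y \<in> C \<and> {y, v} \<in> E. f y v)"
        using fC fC by (rule sum.swap_restrict)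
      then show ?thesis by (simp add: L_def insert_commute)
    qed
    \<comment> \<open>For fixed \<open>v\<close>, \<open>y\<close> runs over the common neighbours
      of \<open>p\<close> and \<open>v\<close> adjacent to \<open>q\<close>: this is row
      \<open>q\<close> of the system for the pair \<open>p\<close>, \<open>v\<close>.\<close>
    have star: "(\<Sum>y\<in>L v. \<theta> p v q + \<theta> p v y) = share p q - share v q"
      if v: "v \<in> C" and pq: "(p = a \<and> q = b) \<or> (p = b \<and> q = a)" for v p q
    proof -
      have "L v = {y. y \<in> common p v \<and> {q, y} \<in> E}"
        using pq by (auto simp: L_def C_def common_def)
      moreover have "q \<in> common p v" "p \<in> V" "v \<in> V"
        using pq e ab yC[OF v] by (auto simp: common_def insert_commute)
      ultimately show ?thesis using sys by simp
    qed
    have star_a: "(\<Sum>y\<in>C. \<Sum>v\<in>L y. \<theta> a v b + \<theta> a v y) = (\<Sum>v\<in>C. share a b - share v b)"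
      by (rule trans[OF swap]) (intro sum.cong refl star, auto)
    have star_b: "(\<Sum>y\<in>C. \<Sum>v\<in>L y. \<theta> b v a + \<theta> b v y) = (\<Sum>v\<in>C. share b a - share v a)"
      by (rule trans[OF swap]) (intro sum.cong refl star, auto)
    \<comment> \<open>Swaps between the triangles \<open>aby\<close> and \<open>abv\<close> leave
      the load of \<open>ab\<close> unchanged.\<close>
    have zero: "(\<Sum>y\<in>C. \<Sum>v\<in>L y. \<theta> y v a + \<theta> y v b) = 0"
    proof -
      have antisum: "\<theta> y v a + \<theta> y v b = - (\<theta> v y a + \<theta> v y b)" for y v
        using anti[of y v a] anti[of y v b] by simp
      have "(\<Sum>y\<in>C. \<Sum>v\<in>L y. \<theta> y v a + \<theta> y v b) = (\<Sum>v\<in>C. \<Sum>y\<in>L v. \<theta> y v a + \<theta> y v b)"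
        by (rule swap)
      also have "\<dots> = (\<Sum>v\<in>C. \<Sum>y\<in>L v. - (\<theta> v y a + \<theta> v y b))"
        by (intro sum.cong refl antisum)
      also have "\<dots> = - (\<Sum>v\<in>C. \<Sum>y\<in>L v. \<theta> v y a + \<theta> v y b)"
        by (simp only: sum_negf)
      finally show ?thesis by simp
    qed
    have "inj_on (\<lambda>y. {a, b, y}) C" using yC by (intro inj_onI) (auto simp: doubleton_eq_iff)
    then have "(\<Sum>T | T \<in> triangles V E \<and> {a, b} \<subseteq> T. w T) = (\<Sum>y\<in>C. w {a, b, y})"
      unfolding triangles_containing[OF e] C_def by (simp add: sum.reindex)
    then have "3 * (\<Sum>T | T \<in> triangles V E \<and> {a, b} \<subseteq> T. w T) = (\<Sum>y\<in>C. 3 * w {a, b, y})"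
      by (simp add: sum_distrib_left)
    also have "\<dots> = (\<Sum>y\<in>C. share a b + share a y + share b y
        + (\<Sum>v\<in>L y. (\<theta> a v b + \<theta> a v y) + (\<theta> b v a + \<theta> b v y) + (\<theta> y v a + \<theta> y v b)))"
      by (intro sum.cong refl w)
    also have "\<dots> = (\<Sum>y\<in>C. share a b + share a y + share b y)
        + ((\<Sum>y\<in>C. \<Sum>v\<in>L y. \<theta> a v b + \<theta> a v y) + (\<Sum>y\<in>C. \<Sum>v\<in>L y. \<theta> b v a + \<theta> b v y)
        + (\<Sum>y\<in>C. \<Sum>v\<in>L y. \<theta> y v a + \<theta> y v b))"
      by (simp only: sum.distrib add.assoc)
    also have "\<dots> = (\<Sum>y\<in>C. share a b + share a y + share b y)
        + ((\<Sum>v\<in>C. share a b - share v b) + (\<Sum>v\<in>C. share b a - share v a) + 0)"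
      by (simp only: star_a star_b zero)
    \<comment> \<open>The negative shares cancel those of the other two edges of the
      triangles.\<close>
    also have "\<dots> = (\<Sum>v\<in>C. 3 * share a b)"
    proof -
      have "(\<Sum>v\<in>C. share v b) = (\<Sum>v\<in>C. share b v)" "(\<Sum>v\<in>C. share v a) = (\<Sum>v\<in>C. share a v)"
        by (intro sum.cong refl share_commute)+
      then show ?thesis by (simp add: sum.distrib sum_subtractf share_commute[of b a])
    qed
    also have "\<dots> = 3" using card_common_pos[OF ab(1,2)] by (simp add: C_def share_def)
    finally show ?thesis by simp
  qed
  have "(\<Sum>T | T \<in> triangles V E \<and> e \<subseteq> T. w T) = 1" if "e \<in> E" for e
  proof -
    have "card e = 2" using graph that by (auto simp: simple_graph_def)
    then obtain a b where "e = {a, b}" by (auto simp: card_2_iff)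
    then show ?thesis using load that by simp
  qed
  then show ?thesis using nonneg unfolding fractional_triangle_decomposition_def by blast
qed

end

section \<open>From minimum degree to numbers of non-neighbours\<close>

theorem theorem1p4:
  fixes V :: "'a set" and E :: "'a set set" and n :: nat
  assumes "simple_graph V E"
    and "card V = n"
    and "real (min_degree V E) \<ge> (7 + sqrt 21) / 14 * real n"
  shows "\<exists>w. fractional_triangle_decomposition V E w"
proof (cases "V = {}")
  \<comment> \<open>Here \<open>min_degree\<close> is unspecified, but there are no edges and any
    weight will do.\<close>
  case True
  then have "E = {}" "triangles V E = {}"
    using assms(1) by (auto simp: simple_graph_def triangles_def)
  then show ?thesis by (simp add: fractional_triangle_decomposition_def)
next
  case False
  have fin: "finite V" using assms(1) by (simp add: simple_graph_def)
  \<comment> \<open>This rational value turns \<open>(7 + sqrt 21) / 14\<close> into exactly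
    \<open>8273/10000\<close>.\<close>
  have "45822/10000 \<le> sqrt 21" by (rule real_le_rsqrt) (simp add: power2_eq_square)
  then have "8273/10000 * real n \<le> (7 + sqrt 21) / 14 * real n" by (intro mult_right_mono) auto
  then have min: "8273/10000 * real n \<le> real (min_degree V E)" using assms(3) by linarith
  have "dense_graph V E"
  proof
    fix v assume v: "v \<in> V"
    have "min_degree V E \<le> degree E v" unfolding min_degree_def using fin v by (intro Min_le) auto
    also have "degree E v = card {w\<in>V. {v, w} \<in> E}"
    proof -
      have "bij_betw (\<lambda>w. {v, w}) {w\<in>V. {v, w} \<in> E} {e\<in>E. v \<in> e}"
      proof (rule bij_betw_imageI)
        show "inj_on (\<lambda>w. {v, w}) {w\<in>V. {v, w} \<in> E}" by (auto simp: inj_on_def doubleton_eq_iff)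
        show "(\<lambda>w. {v, w}) ` {w\<in>V. {v, w} \<in> E} = {e\<in>E. v \<in> e}"
        proof (intro equalityI subsetI)
          fix e assume e: "e \<in> {e\<in>E. v \<in> e}"
          then have "card e = 2" "e \<subseteq> V" using assms(1) by (auto simp: simple_graph_def)
          then obtain w where "e = {v, w}" using e by (auto simp: card_2_iff)
          then show "e \<in> (\<lambda>w. {v, w}) ` {w\<in>V. {v, w} \<in> E}" using e \<open>e \<subseteq> V\<close> by auto
        qed auto
      qed
      then show ?thesis unfolding degree_def by (simp add: bij_betw_same_card)
    qed
    finally have "min_degree V E \<le> card {w\<in>V. {v, w} \<in> E}" .
    moreover have "card {w\<in>V. {v, w} \<in> E} + card {w\<in>V. {v, w} \<notin> E} = n"
    proof -
      have "card ({w\<in>V. {v, w} \<in> E} \<union> {w\<in>V. {v, w} \<notin> E})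
          = card {w\<in>V. {v, w} \<in> E} + card {w\<in>V. {v, w} \<notin> E}"
        using fin by (intro card_Un_disjoint) auto
      moreover have "{w\<in>V. {v, w} \<in> E} \<union> {w\<in>V. {v, w} \<notin> E} = V" by auto
      ultimately show ?thesis using assms(2) by simp
    qed
    ultimately show "real (card {w\<in>V. {v, w} \<notin> E}) \<le> 1727/10000 * real (card V)"
      using min assms(2) by linarith
  qed (use assms False in auto)
  then show ?thesis by (rule dense_graph.fractional_decomposition)
qed

end
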